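(* Let $R$ be a ring and let $n\ge 2$ be an integer. If $T_n(R)$ is a $\sqrt{J}$-clean ring, then $R$ is also a $\sqrt{J}$-clean ring.
   Context: Rings are associative with identity $1\neq 0$ (not necessarily commutative). $J(R)$ is the Jacobson radical of $R$, and $\sqrt{J(R)}=\{z\in R : z^k\in J(R)\text{ for some } k\ge 1\}$. A ring $R$ is $\sqrt{J}$-clean if every $x\in R$ can be written as $x=e+z$ with $e$ an idempotent of $R$ and $z\in\sqrt{J(R)}$. $T_n(R)$ is the ring of all $n\times n$ upper triangular matrices over $R$. *)

theory Defs
  imports "HOL-Algebra.Algebra"
begin

text \<open>
  The \<^locale>\<open>ideal\<close> of HOL-Algebra is two-sided and so is the wrong notion for the Jacobson
  radical of a non-commutative ring.
\<close>

locale left_ideal = additive_subgroup I R + ring R for I and R (structure) +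
  assumes I_l_closed: "\<lbrakk>a \<in> I; x \<in> carrier R\<rbrakk> \<Longrightarrow> x \<otimes> a \<in> I"

locale maximal_left_ideal = left_ideal +
  assumes I_notcarr: "carrier R \<noteq> I"
    and I_maximal: "\<lbrakk>left_ideal J R; I \<subseteq> J; J \<subseteq> carrier R\<rbrakk> \<Longrightarrow> J = I \<or> J = carrier R"

definition jacobson_radical :: "('a, 'm) ring_scheme \<Rightarrow> 'a set" where
  "jacobson_radical R = carrier R \<inter> \<Inter> {M. maximal_left_ideal M R}"

definition sqrt_jacobson :: "('a, 'm) ring_scheme \<Rightarrow> 'a set" where
  "sqrt_jacobson R = {z \<in> carrier R. \<exists>k::nat. k \<ge> 1 \<and> z [^]\<^bsub>R\<^esub> k \<in> jacobson_radical R}"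

definition sqrtJ_clean :: "('a, 'm) ring_scheme \<Rightarrow> bool" where
  "sqrtJ_clean R \<longleftrightarrow>
     (\<forall>x \<in> carrier R. \<exists>e \<in> carrier R. \<exists>z \<in> sqrt_jacobson R.
        e \<otimes>\<^bsub>R\<^esub> e = e \<and> x = e \<oplus>\<^bsub>R\<^esub> z)"

text \<open>
  Rows and columns are indexed by \<open>0, \<dots>, n - 1\<close>. A matrix is an extensional function on
  index pairs, so that equality in the carrier is equality of entries.
\<close>

definition upper_triangular_mats :: "('a, 'm) ring_scheme \<Rightarrow> nat \<Rightarrow> (nat \<times> nat \<Rightarrow> 'a) set" where
  "upper_triangular_mats R n =
     {A \<in> {..<n} \<times> {..<n} \<rightarrow>\<^sub>E carrier R. \<forall>i<n. \<forall>j<i. A (i, j) = \<zero>\<^bsub>R\<^esub>}"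

definition upper_triangular_ring :: "('a, 'm) ring_scheme \<Rightarrow> nat \<Rightarrow> (nat \<times> nat \<Rightarrow> 'a) ring" where
  "upper_triangular_ring R n =
     \<lparr>carrier = upper_triangular_mats R n,
      monoid.mult = (\<lambda>A B. \<lambda>(i, j) \<in> {..<n} \<times> {..<n}. \<Oplus>\<^bsub>R\<^esub>k \<in> {..<n}. A (i, k) \<otimes>\<^bsub>R\<^esub> B (k, j)),
      monoid.one = (\<lambda>(i, j) \<in> {..<n} \<times> {..<n}. if i = j then \<one>\<^bsub>R\<^esub> else \<zero>\<^bsub>R\<^esub>),
      ring.zero = (\<lambda>_ \<in> {..<n} \<times> {..<n}. \<zero>\<^bsub>R\<^esub>),
      ring.add = (\<lambda>A B. \<lambda>p \<in> {..<n} \<times> {..<n}. A p \<oplus>\<^bsub>R\<^esub> B p)\<rparr>"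

lemma (in abelian_monoid) finsum_swap_index:
  assumes "finite A" "finite B" "\<And>i j. i \<in> A \<Longrightarrow> j \<in> B \<Longrightarrow> f i j \<in> carrier G"
  shows "(\<Oplus>i\<in>A. \<Oplus>j\<in>B. f i j) = (\<Oplus>j\<in>B. \<Oplus>i\<in>A. f i j)"
  using assms(1,3)
proof (induction A rule: finite_induct)
  case empty
  show ?case by simp
next
  case (insert a A)
  have "(\<Oplus>i\<in>insert a A. \<Oplus>j\<in>B. f i j) = (\<Oplus>j\<in>B. f a j) \<oplus> (\<Oplus>j\<in>B. \<Oplus>i\<in>A. f i j)"
    using insert by (subst finsum_insert) (auto simp: Pi_def intro!: finsum_closed)
  also have "\<dots> = (\<Oplus>j\<in>B. f a j \<oplus> (\<Oplus>i\<in>A. f i j))"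
    using insert by (subst finsum_addf) (auto simp: Pi_def intro!: finsum_closed)
  also have "\<dots> = (\<Oplus>j\<in>B. \<Oplus>i\<in>insert a A. f i j)"
    using insert by (intro finsum_cong') (auto simp: Pi_def intro!: finsum_closed)
  finally show ?case .
qed

lemma (in ring) upper_triangular_ring_is_ring: "ring (upper_triangular_ring R n)"
proof -
  let ?T = "upper_triangular_ring R n"
  note defs = upper_triangular_ring_def upper_triangular_mats_def
  have entry: "A (i, j) \<in> carrier R" if "A \<in> carrier ?T" "i < n" "j < n" for A i j
    using that by (auto simp: defs PiE_def Pi_def)
  have low: "A (i, j) = \<zero>" if "A \<in> carrier ?T" "i < n" "j < i" for A i j
    using that by (auto simp: defs)
  have memI: "A \<in> carrier ?T"
    if "A \<in> extensional ({..<n} \<times> {..<n})" "\<And>i j. i < n \<Longrightarrow> j < n \<Longrightarrow> A (i, j) \<in> carrier R"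
      "\<And>i j. i < n \<Longrightarrow> j < i \<Longrightarrow> A (i, j) = \<zero>" for A
    using that by (auto simp: defs PiE_def Pi_def)
  have eqI: "A = B" if "A \<in> carrier ?T" "B \<in> carrier ?T"
      "\<And>i j. i < n \<Longrightarrow> j < n \<Longrightarrow> A (i, j) = B (i, j)" for A B
    using that by (intro PiE_ext[of A "{..<n} \<times> {..<n}" "\<lambda>_. carrier R" B]) (auto simp: defs)
  have mult_ap: "(A \<otimes>\<^bsub>?T\<^esub> B) (i, j) = (\<Oplus>k\<in>{..<n}. A (i, k) \<otimes> B (k, j))"
    if "i < n" "j < n" for A B i j using that by (simp add: defs)
  have add_ap: "(A \<oplus>\<^bsub>?T\<^esub> B) (i, j) = A (i, j) \<oplus> B (i, j)" if "i < n" "j < n" for A B i j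
    using that by (simp add: defs)
  have one_ap: "\<one>\<^bsub>?T\<^esub> (i, j) = (if i = j then \<one> else \<zero>)" if "i < n" "j < n" for i j
    using that by (simp add: defs)
  have zero_ap: "\<zero>\<^bsub>?T\<^esub> (i, j) = \<zero>" if "i < n" "j < n" for i j
    using that by (simp add: defs)
  note ap = mult_ap add_ap one_ap zero_ap
  have mult_cl: "A \<otimes>\<^bsub>?T\<^esub> B \<in> carrier ?T" if AB: "A \<in> carrier ?T" "B \<in> carrier ?T" for A B
  proof (rule memI)
    show "A \<otimes>\<^bsub>?T\<^esub> B \<in> extensional ({..<n} \<times> {..<n})" by (simp add: defs)
    show "(A \<otimes>\<^bsub>?T\<^esub> B) (i, j) \<in> carrier R" if "i < n" "j < n" for i j
      using that AB by (auto simp: ap entry intro!: finsum_closed)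
    show "(A \<otimes>\<^bsub>?T\<^esub> B) (i, j) = \<zero>" if "i < n" "j < i" for i j
    proof -
      have "A (i, k) \<otimes> B (k, j) = \<zero>" if "k < n" for k
        using that \<open>i < n\<close> \<open>j < i\<close> AB entry low
        by (cases "k < i") (auto simp: low entry)
      then have "(\<Oplus>k\<in>{..<n}. A (i, k) \<otimes> B (k, j)) = (\<Oplus>k\<in>{..<n}. \<zero>)"
        by (intro finsum_cong') auto
      then show ?thesis using that by (simp add: ap)
    qed
  qed
  have add_cl: "A \<oplus>\<^bsub>?T\<^esub> B \<in> carrier ?T" if "A \<in> carrier ?T" "B \<in> carrier ?T" for A B
    using that by (intro memI) (auto simp: ap entry low, simp add: defs)
  have one_cl: "\<one>\<^bsub>?T\<^esub> \<in> carrier ?T"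
    by (intro memI) (auto simp: ap, simp add: defs)
  have zero_cl: "\<zero>\<^bsub>?T\<^esub> \<in> carrier ?T"
    by (intro memI) (auto simp: ap, simp add: defs)
  have sum_single: "(\<Oplus>k\<in>{..<n}. if k = i then f k else \<zero>) = f i"
    if "i < n" "f \<in> {..<n} \<rightarrow> carrier R" for i f
    using add.finprod_singleton_swap[of i "{..<n}" f] that by simp
  have one_l: "\<one>\<^bsub>?T\<^esub> \<otimes>\<^bsub>?T\<^esub> A = A" if A: "A \<in> carrier ?T" for A
  proof (rule eqI[OF mult_cl[OF one_cl A] A])
    fix i j assume "i < n" "j < n"
    then have "(\<one>\<^bsub>?T\<^esub> \<otimes>\<^bsub>?T\<^esub> A) (i, j) = (\<Oplus>k\<in>{..<n}. if k = i then A (k, j) else \<zero>)"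
      using A by (simp add: mult_ap, intro finsum_cong') (auto simp: ap entry)
    then show "(\<one>\<^bsub>?T\<^esub> \<otimes>\<^bsub>?T\<^esub> A) (i, j) = A (i, j)"
      using A \<open>i < n\<close> \<open>j < n\<close> sum_single[of i "\<lambda>k. A (k, j)"] by (auto simp: entry)
  qed
  have one_r: "A \<otimes>\<^bsub>?T\<^esub> \<one>\<^bsub>?T\<^esub> = A" if A: "A \<in> carrier ?T" for A
  proof (rule eqI[OF mult_cl[OF A one_cl] A])
    fix i j assume "i < n" "j < n"
    then have "(A \<otimes>\<^bsub>?T\<^esub> \<one>\<^bsub>?T\<^esub>) (i, j) = (\<Oplus>k\<in>{..<n}. if k = j then A (i, k) else \<zero>)"
      using A by (simp add: mult_ap, intro finsum_cong') (auto simp: ap entry)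
    then show "(A \<otimes>\<^bsub>?T\<^esub> \<one>\<^bsub>?T\<^esub>) (i, j) = A (i, j)"
      using A \<open>i < n\<close> \<open>j < n\<close> sum_single[of j "\<lambda>k. A (i, k)"] by (auto simp: entry)
  qed
  have assoc: "(A \<otimes>\<^bsub>?T\<^esub> B) \<otimes>\<^bsub>?T\<^esub> C = A \<otimes>\<^bsub>?T\<^esub> (B \<otimes>\<^bsub>?T\<^esub> C)"
    if A: "A \<in> carrier ?T" and B: "B \<in> carrier ?T" and C: "C \<in> carrier ?T" for A B C
  proof (rule eqI[OF mult_cl[OF mult_cl[OF A B] C] mult_cl[OF A mult_cl[OF B C]]])
    fix i j assume ij: "i < n" "j < n"
    have "((A \<otimes>\<^bsub>?T\<^esub> B) \<otimes>\<^bsub>?T\<^esub> C) (i, j)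
        = (\<Oplus>k\<in>{..<n}. (\<Oplus>l\<in>{..<n}. A (i, l) \<otimes> B (l, k)) \<otimes> C (k, j))"
      using ij A B C
      by (simp add: mult_ap, intro finsum_cong') (auto simp: ap entry intro!: finsum_closed)
    also have "\<dots> = (\<Oplus>k\<in>{..<n}. \<Oplus>l\<in>{..<n}. A (i, l) \<otimes> (B (l, k) \<otimes> C (k, j)))"
      using ij A B C
      by (intro finsum_cong')
        (auto simp: entry finsum_ldistr m_assoc Pi_def intro!: finsum_closed finsum_cong')
    also have "\<dots> = (\<Oplus>l\<in>{..<n}. \<Oplus>k\<in>{..<n}. A (i, l) \<otimes> (B (l, k) \<otimes> C (k, j)))"
      using ij A B C by (intro finsum_swap_index) (auto simp: entry)
    also have "\<dots> = (\<Oplus>l\<in>{..<n}. A (i, l) \<otimes> (\<Oplus>k\<in>{..<n}. B (l, k) \<otimes> C (k, j)))"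
      using ij A B C
      by (intro finsum_cong') (auto simp: entry finsum_rdistr Pi_def intro!: finsum_closed)
    also have "\<dots> = (A \<otimes>\<^bsub>?T\<^esub> (B \<otimes>\<^bsub>?T\<^esub> C)) (i, j)"
      using ij A B C
      by (simp add: mult_ap, intro finsum_cong') (auto simp: ap entry intro!: finsum_closed)
    finally show "((A \<otimes>\<^bsub>?T\<^esub> B) \<otimes>\<^bsub>?T\<^esub> C) (i, j) = (A \<otimes>\<^bsub>?T\<^esub> (B \<otimes>\<^bsub>?T\<^esub> C)) (i, j)" .
  qed
  have dist_r: "(A \<oplus>\<^bsub>?T\<^esub> B) \<otimes>\<^bsub>?T\<^esub> C = A \<otimes>\<^bsub>?T\<^esub> C \<oplus>\<^bsub>?T\<^esub> B \<otimes>\<^bsub>?T\<^esub> C"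
    if A: "A \<in> carrier ?T" and B: "B \<in> carrier ?T" and C: "C \<in> carrier ?T" for A B C
  proof (rule eqI[OF mult_cl[OF add_cl[OF A B] C] add_cl[OF mult_cl[OF A C] mult_cl[OF B C]]])
    fix i j assume ij: "i < n" "j < n"
    have "((A \<oplus>\<^bsub>?T\<^esub> B) \<otimes>\<^bsub>?T\<^esub> C) (i, j)
        = (\<Oplus>k\<in>{..<n}. A (i, k) \<otimes> C (k, j) \<oplus> B (i, k) \<otimes> C (k, j))"
      using ij A B C by (simp add: mult_ap, intro finsum_cong') (auto simp: ap entry l_distr)
    then show "((A \<oplus>\<^bsub>?T\<^esub> B) \<otimes>\<^bsub>?T\<^esub> C) (i, j) = (A \<otimes>\<^bsub>?T\<^esub> C \<oplus>\<^bsub>?T\<^esub> B \<otimes>\<^bsub>?T\<^esub> C) (i, j)"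
      using ij A B C by (simp add: ap finsum_addf entry Pi_def)
  qed
  have dist_l: "C \<otimes>\<^bsub>?T\<^esub> (A \<oplus>\<^bsub>?T\<^esub> B) = C \<otimes>\<^bsub>?T\<^esub> A \<oplus>\<^bsub>?T\<^esub> C \<otimes>\<^bsub>?T\<^esub> B"
    if A: "A \<in> carrier ?T" and B: "B \<in> carrier ?T" and C: "C \<in> carrier ?T" for A B C
  proof (rule eqI[OF mult_cl[OF C add_cl[OF A B]] add_cl[OF mult_cl[OF C A] mult_cl[OF C B]]])
    fix i j assume ij: "i < n" "j < n"
    have "(C \<otimes>\<^bsub>?T\<^esub> (A \<oplus>\<^bsub>?T\<^esub> B)) (i, j)
        = (\<Oplus>k\<in>{..<n}. C (i, k) \<otimes> A (k, j) \<oplus> C (i, k) \<otimes> B (k, j))"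
      using ij A B C by (simp add: mult_ap, intro finsum_cong') (auto simp: ap entry r_distr)
    then show "(C \<otimes>\<^bsub>?T\<^esub> (A \<oplus>\<^bsub>?T\<^esub> B)) (i, j) = (C \<otimes>\<^bsub>?T\<^esub> A \<oplus>\<^bsub>?T\<^esub> C \<otimes>\<^bsub>?T\<^esub> B) (i, j)"
      using ij A B C by (simp add: ap finsum_addf entry Pi_def)
  qed
  show ?thesis
  proof (rule ringI)
    show "abelian_group ?T"
    proof (rule abelian_groupI)
      fix A assume A: "A \<in> carrier ?T"
      let ?N = "\<lambda>p \<in> {..<n} \<times> {..<n}. \<ominus> A p"
      have N: "?N \<in> carrier ?T" using A by (intro memI) (auto simp: entry low)
      have "?N \<oplus>\<^bsub>?T\<^esub> A = \<zero>\<^bsub>?T\<^esub>"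
        using A by (intro eqI[OF add_cl[OF N A] zero_cl]) (auto simp: ap entry l_neg)
      then show "\<exists>B\<in>carrier ?T. B \<oplus>\<^bsub>?T\<^esub> A = \<zero>\<^bsub>?T\<^esub>" using N by blast
    qed (auto simp: add_cl zero_cl ap entry a_ac intro!: eqI)
    show "monoid ?T"
      by (rule monoidI) (simp_all add: mult_cl one_cl one_l one_r assoc)
  qed (simp_all add: dist_l dist_r)
qed

end

theory Submission
  imports Defs
begin

text \<open>
  Reading off the top left entry is a surjective ring homomorphism \<open>T\<^sub>n(R) \<rightarrow> R\<close>: in an upper
  triangular product \<open>AB\<close> the first column of \<open>B\<close> vanishes below the diagonal, so the only term
  left in the top left entry is \<open>A\<^sub>0\<^sub>0B\<^sub>0\<^sub>0\<close>. It is therefore enough that \<open>\<surd>J\<close>-cleanness passes to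
  homomorphic images.

  Idempotents, sums and powers are carried along by any homomorphism, so the one thing to check is
  that a surjection \<open>f: T \<rightarrow> R\<close> maps \<open>J(T)\<close> into \<open>J(R)\<close>. This holds because maximal left ideals
  of \<open>R\<close> pull back to maximal left ideals of \<open>T\<close>: an element of \<open>J(T)\<close> lies in all of these
  preimages (\<open>vimage_maximal_left_ideal\<close>), so its image lies in every maximal left ideal of \<open>R\<close>.
\<close>

lemma left_idealI:
  assumes "ring R" and "I \<subseteq> carrier R" and "\<zero>\<^bsub>R\<^esub> \<in> I"
    and add: "\<And>a b. a \<in> I \<Longrightarrow> b \<in> I \<Longrightarrow> a \<oplus>\<^bsub>R\<^esub> b \<in> I"
    and mult: "\<And>a x. a \<in> I \<Longrightarrow> x \<in> carrier R \<Longrightarrow> x \<otimes>\<^bsub>R\<^esub> a \<in> I"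
  shows "left_ideal I R"
proof -
  interpret ring R by fact
  \<comment> \<open>Closure under negation is free, since \<open>- a = (- 1) a\<close>.\<close>
  have neg: "\<ominus>\<^bsub>R\<^esub> a \<in> I" if "a \<in> I" for a
    using mult[OF that, of "\<ominus>\<^bsub>R\<^esub> \<one>\<^bsub>R\<^esub>"] that assms(2) by (auto simp: l_minus)
  have "subgroup I (add_monoid R)"
    using assms neg by (intro add.subgroupI) (auto simp: a_inv_def)
  then show ?thesis
    by (intro left_ideal.intro left_ideal_axioms.intro additive_subgroup.intro assms(1) mult) auto
qed

context ring_hom_ring
begin

lemma vimage_left_ideal:
  assumes "left_ideal I S"
  shows "left_ideal {a \<in> carrier R. h a \<in> I} R"
proof -
  interpret I: left_ideal I S by fact
  show ?thesis
    by (rule left_idealI) (auto simp: R.ring_axioms I.I_l_closed)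
qed

lemma image_left_ideal:
  assumes "left_ideal I R" and surj: "h ` carrier R = carrier S"
  shows "left_ideal (h ` I) S"
proof (rule left_idealI)
  interpret I: left_ideal I R by fact
  show "ring S" by (rule S.ring_axioms)
  show "h ` I \<subseteq> carrier S" by (auto simp: I.a_Hcarr)
  show "\<zero>\<^bsub>S\<^esub> \<in> h ` I"
    by (rule image_eqI[of _ _ "\<zero>\<^bsub>R\<^esub>"]) auto
  show "a \<oplus>\<^bsub>S\<^esub> b \<in> h ` I" if ab: "a \<in> h ` I" "b \<in> h ` I" for a b
  proof -
    obtain c d where "c \<in> I" "d \<in> I" "a = h c" "b = h d" using ab by auto
    then show ?thesis by (intro image_eqI[of _ _ "c \<oplus>\<^bsub>R\<^esub> d"]) (auto simp: I.a_Hcarr)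
  qed
  \<comment> \<open>Scalars from \<open>S\<close> must be lifted to \<open>R\<close>; this is where surjectivity enters.\<close>
  show "x \<otimes>\<^bsub>S\<^esub> a \<in> h ` I" if ax: "a \<in> h ` I" "x \<in> carrier S" for a x
  proof -
    obtain c where c: "c \<in> I" "a = h c" using ax(1) by auto
    obtain y where y: "y \<in> carrier R" "x = h y" using ax(2) surj by auto
    show ?thesis
      using c y by (intro image_eqI[of _ _ "y \<otimes>\<^bsub>R\<^esub> c"]) (auto simp: I.a_Hcarr I.I_l_closed)
  qed
qed

text \<open>
  The correspondence theorem for left ideals, restricted to the maximal ones. A left ideal \<open>J\<close>
  above the preimage of \<open>M\<close> has an image above \<open>M\<close>, which is \<open>M\<close> or everything; and \<open>J\<close> is
  recovered from its image because it contains the kernel of \<open>h\<close>.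
\<close>

lemma vimage_maximal_left_ideal:
  assumes "maximal_left_ideal M S" and surj: "h ` carrier R = carrier S"
  shows "maximal_left_ideal {a \<in> carrier R. h a \<in> M} R"
proof -
  interpret M: maximal_left_ideal M S by fact
  let ?P = "{a \<in> carrier R. h a \<in> M}"
  have "carrier R \<noteq> ?P"
  proof
    assume "carrier R = ?P"
    then have "h ` carrier R \<subseteq> M" by auto
    then show False using surj M.a_subset M.I_notcarr by simp
  qed
  moreover have "J = ?P \<or> J = carrier R"
    if J: "left_ideal J R" "?P \<subseteq> J" "J \<subseteq> carrier R" for J
  proof -
    interpret J: left_ideal J R by fact
    have "M \<subseteq> h ` J"
    proof
      fix m assume "m \<in> M"
      moreover from this obtain a where "a \<in> carrier R" "m = h a"
        using M.a_Hcarr surj by (metis imageE)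
      ultimately show "m \<in> h ` J" using J(2) by auto
    qed
    moreover have "h ` J \<subseteq> carrier S" using J(3) by auto
    ultimately consider "h ` J = M" | "h ` J = carrier S"
      using M.I_maximal[OF image_left_ideal[OF J(1) surj]] by auto
    then show ?thesis
    proof cases
      case 1
      then show ?thesis using J(2,3) by blast
    next
      case 2
      have "x \<in> J" if x: "x \<in> carrier R" for x
      proof -
        obtain y where y: "y \<in> J" "h x = h y" using 2 x by (metis hom_closed imageE)
        then have yR: "y \<in> carrier R" using J(3) by auto
        have "h (x \<ominus>\<^bsub>R\<^esub> y) = \<zero>\<^bsub>S\<^esub>"
          using x yR y(2) by (simp add: R.minus_eq S.r_neg)
        then have "x \<ominus>\<^bsub>R\<^esub> y \<in> J" using J(2) x yR by auto
        then have "(x \<ominus>\<^bsub>R\<^esub> y) \<oplus>\<^bsub>R\<^esub> y \<in> J" using y(1) by simp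
        then show "x \<in> J" using x yR by (simp add: R.minus_eq R.a_assoc R.l_neg)
      qed
      then show ?thesis using J(3) by blast
    qed
  qed
  ultimately show ?thesis
    by (intro maximal_left_ideal.intro maximal_left_ideal_axioms.intro
        vimage_left_ideal M.left_ideal_axioms)
qed

lemma hom_jacobson_radical:
  assumes "h ` carrier R = carrier S" and "x \<in> jacobson_radical R"
  shows "h x \<in> jacobson_radical S"
  using assms(2) vimage_maximal_left_ideal[OF _ assms(1)] by (auto simp: jacobson_radical_def)

lemma hom_sqrt_jacobson:
  assumes "h ` carrier R = carrier S" and "z \<in> sqrt_jacobson R"
  shows "h z \<in> sqrt_jacobson S"
proof -
  obtain k :: nat where z: "z \<in> carrier R" "k \<ge> 1" "z [^]\<^bsub>R\<^esub> k \<in> jacobson_radical R"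
    using assms(2) by (auto simp: sqrt_jacobson_def)
  have "h z [^]\<^bsub>S\<^esub> k = h (z [^]\<^bsub>R\<^esub> k)" using z(1) by (simp add: hom_nat_pow)
  then have "h z [^]\<^bsub>S\<^esub> k \<in> jacobson_radical S"
    using hom_jacobson_radical[OF assms(1) z(3)] by simp
  then show ?thesis unfolding sqrt_jacobson_def using z(1,2) hom_closed by blast
qed

lemma sqrtJ_clean_image:
  assumes surj: "h ` carrier R = carrier S" and clean: "sqrtJ_clean R"
  shows "sqrtJ_clean S"
  unfolding sqrtJ_clean_def
proof
  fix x assume "x \<in> carrier S"
  then obtain a where a: "a \<in> carrier R" "x = h a" using surj by auto
  then obtain e z where e: "e \<in> carrier R" "e \<otimes>\<^bsub>R\<^esub> e = e"
    and z: "z \<in> sqrt_jacobson R" "a = e \<oplus>\<^bsub>R\<^esub> z"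
    using clean unfolding sqrtJ_clean_def by blast
  have "z \<in> carrier R" using z(1) by (simp add: sqrt_jacobson_def)
  then have "h e \<otimes>\<^bsub>S\<^esub> h e = h e" "x = h e \<oplus>\<^bsub>S\<^esub> h z"
    using e z a hom_mult[of e e] by auto
  then show "\<exists>e\<in>carrier S. \<exists>z\<in>sqrt_jacobson S. e \<otimes>\<^bsub>S\<^esub> e = e \<and> x = e \<oplus>\<^bsub>S\<^esub> z"
    using hom_sqrt_jacobson[OF surj z(1)] e(1)
    by (intro bexI[of _ "h e"] bexI[of _ "h z"] conjI) auto
qed

end

context ring
begin

lemma top_left_entry_ring_hom:
  assumes "n > 0"
  shows "ring_hom_ring (upper_triangular_ring R n) R (\<lambda>A. A (0, 0))"
proof (rule ring_hom_ringI)
  let ?T = "upper_triangular_ring R n"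
  note defs = upper_triangular_ring_def upper_triangular_mats_def
  have entry: "A (i, j) \<in> carrier R" if "A \<in> carrier ?T" "i < n" "j < n" for A i j
    using that by (auto simp: defs PiE_def Pi_def)
  show "ring ?T" by (rule upper_triangular_ring_is_ring)
  show "ring R" by (rule ring_axioms)
  show "A (0, 0) \<in> carrier R" if "A \<in> carrier ?T" for A
    using entry that assms by blast
  show "(A \<otimes>\<^bsub>?T\<^esub> B) (0, 0) = A (0, 0) \<otimes> B (0, 0)"
    if AB: "A \<in> carrier ?T" "B \<in> carrier ?T" for A B
  proof -
    have "(A \<otimes>\<^bsub>?T\<^esub> B) (0, 0) = (\<Oplus>k\<in>{..<n}. A (0, k) \<otimes> B (k, 0))"
      using assms by (simp add: defs)
    also have "\<dots> = (\<Oplus>k\<in>{..<n}. if k = 0 then A (0, k) \<otimes> B (k, 0) else \<zero>)"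
    proof (intro finsum_cong')
      fix k assume k: "k \<in> {..<n}"
      then have "B (k, 0) = \<zero>" if "k \<noteq> 0" using AB(2) that by (simp add: defs)
      then show "A (0, k) \<otimes> B (k, 0) = (if k = 0 then A (0, k) \<otimes> B (k, 0) else \<zero>)"
        using entry[OF AB(1) assms, of k] k by auto
    qed (use AB assms entry in auto)
    also have "\<dots> = A (0, 0) \<otimes> B (0, 0)"
      using add.finprod_singleton_swap[of 0 "{..<n}" "\<lambda>k. A (0, k) \<otimes> B (k, 0)"] AB assms entry
      by auto
    finally show ?thesis .
  qed
  show "(A \<oplus>\<^bsub>?T\<^esub> B) (0, 0) = A (0, 0) \<oplus> B (0, 0)" for A B
    using assms by (simp add: defs)
  show "\<one>\<^bsub>?T\<^esub> (0, 0) = \<one>" using assms by (simp add: defs)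
qed

lemma top_left_entry_surj:
  assumes "n > 0"
  shows "(\<lambda>A. A (0, 0)) ` carrier (upper_triangular_ring R n) = carrier R"
proof
  let ?T = "upper_triangular_ring R n"
  interpret ring_hom_ring ?T R "\<lambda>A. A (0, 0)" by (rule top_left_entry_ring_hom[OF assms])
  show "(\<lambda>A. A (0, 0)) ` carrier ?T \<subseteq> carrier R" by (auto intro: hom_closed)
  show "carrier R \<subseteq> (\<lambda>A. A (0, 0)) ` carrier ?T"
  proof
    fix x assume x: "x \<in> carrier R"
    let ?A = "\<lambda>p \<in> {..<n} \<times> {..<n}. if p = (0, 0) then x else \<zero>"
    have "?A \<in> carrier ?T"
      using x by (auto simp: upper_triangular_ring_def upper_triangular_mats_def)
    then show "x \<in> (\<lambda>A. A (0, 0)) ` carrier ?T"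
      using assms by (intro image_eqI[of _ _ ?A]) auto
  qed
qed

end

theorem corollary5p9:
  fixes R :: "('a, 'm) ring_scheme" and n :: nat
  assumes "ring R" and "\<one>\<^bsub>R\<^esub> \<noteq> \<zero>\<^bsub>R\<^esub>"
    and "n \<ge> 2"
    and "sqrtJ_clean (upper_triangular_ring R n)"
  shows "sqrtJ_clean R"
proof -
  interpret ring R by fact
  have n: "n > 0" using assms(3) by simp
  show ?thesis
    by (rule ring_hom_ring.sqrtJ_clean_image[OF top_left_entry_ring_hom[OF n]
          top_left_entry_surj[OF n] assms(4)])
qed

end
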